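(* Let $i\in\{1,2\}$ and let $\mathcal{S}_i$ be the timelike general rotational surface of first type ($i=1$) or second type ($i=2$) determined by $f,g,\alpha,\beta$. Let $\lambda_1,\lambda_2,\lambda_3,\lambda_4\in\mathbb{R}$ be not all zero with $\lambda_1+\lambda_2+\lambda_3=\lambda_4$, and equip $\mathbb{E}_1^4$ with the density $e^{\lambda_1x^2+\lambda_2y^2+\lambda_3z^2+\lambda_4t^2}$. If the functions $f$ and $g$ are linearly dependent on $J$, then $\mathcal{S}_i$ is weighted flat.
   Context: $\mathbb{E}_1^4$ is $\mathbb{R}^4$ with coordinates $(x,y,z,t)$ and the metric $dx^2+dy^2+dz^2-dt^2$. Let $\alpha,\beta>0$ be constants, $J\subset\mathbb{R}$ an open interval, $f,g:J\to\mathbb{R}$ smooth functions of $u$ (primes denote $d/du$), and $v\in[0,2\pi)$. First type: $\mathcal{S}_1: X_1(u,v)=(f\cos(\alpha v),f\sin(\alpha v),g\cosh(\beta v),g\sinh(\beta v))$ with $\alpha^2f^2-\beta^2g^2<0$ and $f'^2+g'^2>0$ on $J$. Second type: $\mathcal{S}_2: X_2(u,v)=(f\cos(\alpha v),f\sin(\alpha v),g\sinh(\beta v),g\cosh(\beta v))$ with $f'^2-g'^2<0$ and $\alpha^2f^2+\beta^2g^2>0$ on $J$. Both surfaces are timelike. With $\varepsilon=(-1)^i$, the Gaussian curvature of $\mathcal{S}_i$ is $$K^{\mathcal{S}_i}=\frac{\alpha^2\beta^2(gf'-fg')^2(-\varepsilon f'^2+g'^2)+\left(\varepsilon(\alpha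 f)^2+(\beta g)^2\right)(\alpha^2fg'+\beta^2gf')(f''g'-f'g'')}{\left((\alpha f)^2+\varepsilon(\beta g)^2\right)^2(-\varepsilon f'^2+g'^2)^2}.$$ For a density $e^\phi$ on $\mathbb{E}_1^4$, the weighted Gaussian curvature is $K_\phi^{\mathcal{S}_i}=K^{\mathcal{S}_i}-\Delta\phi$, where $\Delta$ is the Laplacian of $\mathbb{E}_1^4$, $\Delta\phi=\phi_{xx}+\phi_{yy}+\phi_{zz}-\phi_{tt}$. The surface is weighted flat if $K_\phi^{\mathcal{S}_i}$ vanishes identically. *)

theory Defs
  imports "HOL-Analysis.Analysis"
begin

definition smooth_on :: "(real \<Rightarrow> real) \<Rightarrow> real set \<Rightarrow> bool" where
  "smooth_on f J \<longleftrightarrow> (\<forall>n. \<forall>u\<in>J. (deriv ^^ n) f differentiable (at u))"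

definition linearly_dependent_on :: "(real \<Rightarrow> real) \<Rightarrow> (real \<Rightarrow> real) \<Rightarrow> real set \<Rightarrow> bool" where
  "linearly_dependent_on f g J \<longleftrightarrow>
    (\<exists>a b :: real. (a, b) \<noteq> (0, 0) \<and> (\<forall>u\<in>J. a * f u + b * g u = 0))"

text \<open>
  The space \<open>\<real>\<^sup>4\<close> with coordinates \<open>(x, y, z, t)\<close>, these being the components 1, 2, 3, 4, and the
  metric \<open>dx\<^sup>2 + dy\<^sup>2 + dz\<^sup>2 - dt\<^sup>2\<close>.
\<close>

definition lorentz :: "real^4 \<Rightarrow> real^4 \<Rightarrow> real" where
  "lorentz p q = p$1 * q$1 + p$2 * q$2 + p$3 * q$3 - p$4 * q$4"

definition partial :: "4 \<Rightarrow> (real^4 \<Rightarrow> real) \<Rightarrow> real^4 \<Rightarrow> real" where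
  "partial k \<phi> p = deriv (\<lambda>h. \<phi> (p + h *\<^sub>R axis k 1)) 0"

definition laplacian :: "(real^4 \<Rightarrow> real) \<Rightarrow> real^4 \<Rightarrow> real" where
  "laplacian \<phi> p =
     partial 1 (partial 1 \<phi>) p + partial 2 (partial 2 \<phi>) p
     + partial 3 (partial 3 \<phi>) p - partial 4 (partial 4 \<phi>) p"

type_synonym surface = "real \<Rightarrow> real \<Rightarrow> real^4"

definition d_u :: "surface \<Rightarrow> surface" where
  "d_u X u v = vector_derivative (\<lambda>s. X s v) (at u)"

definition d_v :: "surface \<Rightarrow> surface" where
  "d_v X u v = vector_derivative (\<lambda>s. X u s) (at v)"

definition form_E :: "surface \<Rightarrow> real \<Rightarrow> real \<Rightarrow> real" where
  "form_E X u v = lorentz (d_u X u v) (d_u X u v)"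

definition form_F :: "surface \<Rightarrow> real \<Rightarrow> real \<Rightarrow> real" where
  "form_F X u v = lorentz (d_u X u v) (d_v X u v)"

definition form_G :: "surface \<Rightarrow> real \<Rightarrow> real \<Rightarrow> real" where
  "form_G X u v = lorentz (d_v X u v) (d_v X u v)"

definition form_W :: "surface \<Rightarrow> real \<Rightarrow> real \<Rightarrow> real" where
  "form_W X u v = form_E X u v * form_G X u v - (form_F X u v)\<^sup>2"

definition timelike_at :: "surface \<Rightarrow> real \<Rightarrow> real \<Rightarrow> bool" where
  "timelike_at X u v \<longleftrightarrow> form_W X u v < 0"

text \<open>
  The component of \<open>w\<close> normal to the surface: the coefficients of the tangential part solve the
  \<open>2 \<times> 2\<close> linear system given by the first fundamental form, so this is meaningful where
  \<open>form_W X u v \<noteq> 0\<close>.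
\<close>

definition normal_part :: "surface \<Rightarrow> real \<Rightarrow> real \<Rightarrow> real^4 \<Rightarrow> real^4" where
  "normal_part X u v w =
     w - ((form_G X u v * lorentz w (d_u X u v) - form_F X u v * lorentz w (d_v X u v))
            / form_W X u v) *\<^sub>R d_u X u v
       - ((form_E X u v * lorentz w (d_v X u v) - form_F X u v * lorentz w (d_u X u v))
            / form_W X u v) *\<^sub>R d_v X u v"

text \<open>
  The Gaussian curvature of a surface with nondegenerate induced metric, by the Gauss equation in
  the flat ambient space, where \<open>h\<close> denotes the second fundamental form:
  \<open>(\<langle>h(X\<^sub>u, X\<^sub>u), h(X\<^sub>v, X\<^sub>v)\<rangle> - \<langle>h(X\<^sub>u, X\<^sub>v), h(X\<^sub>u, X\<^sub>v)\<rangle>) / (E G - F\<^sup>2)\<close>.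
\<close>

definition gaussian_curvature :: "surface \<Rightarrow> real \<Rightarrow> real \<Rightarrow> real" where
  "gaussian_curvature X u v =
     (lorentz (normal_part X u v (d_u (d_u X) u v)) (normal_part X u v (d_v (d_v X) u v))
      - lorentz (normal_part X u v (d_u (d_v X) u v)) (normal_part X u v (d_u (d_v X) u v)))
     / form_W X u v"

text \<open>In the following two definitions the density is \<open>e\<^sup>\<phi>\<close>; the argument is the exponent \<open>\<phi>\<close>.\<close>

definition weighted_gaussian_curvature ::
    "(real^4 \<Rightarrow> real) \<Rightarrow> surface \<Rightarrow> real \<Rightarrow> real \<Rightarrow> real" where
  "weighted_gaussian_curvature \<phi> X u v = gaussian_curvature X u v - laplacian \<phi> (X u v)"

definition weighted_flat_on :: "(real^4 \<Rightarrow> real) \<Rightarrow> surface \<Rightarrow> (real \<times> real) set \<Rightarrow> bool" where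
  "weighted_flat_on \<phi> X D \<longleftrightarrow> (\<forall>(u, v)\<in>D. weighted_gaussian_curvature \<phi> X u v = 0)"

text \<open>
  The general rotational surfaces of first type (\<open>i = 1\<close>) and of second type; only \<open>i = 1\<close> and
  \<open>i = 2\<close> are meant to be used.
\<close>

definition rotational_surface ::
    "nat \<Rightarrow> real \<Rightarrow> real \<Rightarrow> (real \<Rightarrow> real) \<Rightarrow> (real \<Rightarrow> real) \<Rightarrow> surface" where
  "rotational_surface i \<alpha> \<beta> f g u v =
     (if i = 1
      then vector [f u * cos (\<alpha> * v), f u * sin (\<alpha> * v), g u * cosh (\<beta> * v), g u * sinh (\<beta> * v)]
      else vector [f u * cos (\<alpha> * v), f u * sin (\<alpha> * v), g u * sinh (\<beta> * v), g u * cosh (\<beta> * v)])"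

definition rotational_curvature ::
    "nat \<Rightarrow> real \<Rightarrow> real \<Rightarrow> (real \<Rightarrow> real) \<Rightarrow> (real \<Rightarrow> real) \<Rightarrow> real \<Rightarrow> real" where
  "rotational_curvature i \<alpha> \<beta> f g u =
    (let \<epsilon> = (-1) ^ i; F = f u; G = g u;
         F' = deriv f u; G' = deriv g u; F'' = deriv (deriv f) u; G'' = deriv (deriv g) u
     in (\<alpha>\<^sup>2 * \<beta>\<^sup>2 * (G * F' - F * G')\<^sup>2 * (- \<epsilon> * F'\<^sup>2 + G'\<^sup>2)
         + (\<epsilon> * (\<alpha> * F)\<^sup>2 + (\<beta> * G)\<^sup>2) * (\<alpha>\<^sup>2 * F * G' + \<beta>\<^sup>2 * G * F') * (F'' * G' - F' * G''))
        / (((\<alpha> * F)\<^sup>2 + \<epsilon> * (\<beta> * G)\<^sup>2)\<^sup>2 * (- \<epsilon> * F'\<^sup>2 + G'\<^sup>2)\<^sup>2))"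

text \<open>
  The rest of this theory proves that, under the hypotheses on \<open>f\<close> and \<open>g\<close> for the respective type,
  the surfaces are timelike and their Gaussian curvature is \<^const>\<open>rotational_curvature\<close>.
\<close>

lemma vector_4 [simp]:
  "(vector [a, b, c, d] :: real^4) $ 1 = a"
  "(vector [a, b, c, d] :: real^4) $ 2 = b"
  "(vector [a, b, c, d] :: real^4) $ 3 = c"
  "(vector [a, b, c, d] :: real^4) $ 4 = d"
  by (simp_all add: vector_def)

lemma vector_4_axis:
  "(vector [a, b, c, d] :: real^4)
    = a *\<^sub>R axis 1 1 + b *\<^sub>R axis 2 1 + c *\<^sub>R axis 3 1 + d *\<^sub>R axis 4 1"
  by (simp add: vec_eq_iff forall_4 axis_def)

lemma has_vector_derivative_vector_4:
  assumes "(a has_real_derivative a') (at s)" "(b has_real_derivative b') (at s)"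
    and "(c has_real_derivative c') (at s)" "(d has_real_derivative d') (at s)"
  shows "((\<lambda>s. vector [a s, b s, c s, d s] :: real^4)
           has_vector_derivative vector [a', b', c', d']) (at s)"
  unfolding vector_4_axis using assms
  by (intro derivative_eq_intros) (auto intro!: derivative_eq_intros)

lemma lorentz_simps:
  "lorentz (p - q) r = lorentz p r - lorentz q r" "lorentz r (p - q) = lorentz r p - lorentz r q"
  "lorentz (k *\<^sub>R p) r = k * lorentz p r" "lorentz r (k *\<^sub>R p) = k * lorentz r p"
  by (simp_all add: lorentz_def algebra_simps)

lemma lorentz_commute: "lorentz p q = lorentz q p"
  by (simp add: lorentz_def algebra_simps)

lemma lorentz_normal_part:
  assumes "form_F X u v = 0" "form_E X u v \<noteq> 0" "form_G X u v \<noteq> 0"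
  shows "lorentz (normal_part X u v p) (normal_part X u v q)
    = lorentz p q - lorentz p (d_u X u v) * lorentz q (d_u X u v) / form_E X u v
      - lorentz p (d_v X u v) * lorentz q (d_v X u v) / form_G X u v"
proof -
  have F: "lorentz (d_u X u v) (d_v X u v) = 0" "lorentz (d_v X u v) (d_u X u v) = 0"
    using assms(1) by (simp_all add: form_F_def lorentz_commute)
  have EG: "lorentz (d_u X u v) (d_u X u v) = form_E X u v"
      "lorentz (d_v X u v) (d_v X u v) = form_G X u v"
    by (simp_all add: form_E_def form_G_def)
  have N: "normal_part X u v w = w - (lorentz w (d_u X u v) / form_E X u v) *\<^sub>R d_u X u v
      - (lorentz w (d_v X u v) / form_G X u v) *\<^sub>R d_v X u v" for w
    using assms by (simp add: normal_part_def form_W_def)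
  show ?thesis
    unfolding N lorentz_simps F EG lorentz_commute[of "d_u X u v" q] lorentz_commute[of "d_v X u v" q]
    using assms(2,3) by (simp add: field_simps)
qed

lemma smooth_onD:
  assumes "smooth_on f J" "u \<in> J"
  shows "(f has_real_derivative deriv f u) (at u)"
    and "(deriv f has_real_derivative deriv (deriv f) u) (at u)"
proof -
  have "(deriv ^^ 0) f differentiable (at u)" "(deriv ^^ 1) f differentiable (at u)"
    using assms unfolding smooth_on_def by blast+
  then show "(f has_real_derivative deriv f u) (at u)"
      "(deriv f has_real_derivative deriv (deriv f) u) (at u)"
    by (simp_all add: real_differentiable_def field_differentiable_def DERIV_deriv_iff_field_differentiable)
qed

lemma rotational_aux:
  fixes A B :: "real \<Rightarrow> real" and \<alpha> \<beta> \<delta> :: real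
  assumes J: "open J" and f: "smooth_on f J" and g: "smooth_on g J" and u: "u \<in> J"
    and A: "\<And>s. (A has_real_derivative \<beta> * B s) (at s)"
    and B: "\<And>s. (B has_real_derivative \<beta> * A s) (at s)"
    and AB: "\<And>s. (A s)\<^sup>2 - (B s)\<^sup>2 = \<delta>"
  defines "X \<equiv> \<lambda>u v. vector [f u * cos (\<alpha> * v), f u * sin (\<alpha> * v), g u * A v, g u * B v] :: real^4"
  defines "E \<equiv> (deriv f u)\<^sup>2 + \<delta> * (deriv g u)\<^sup>2"
  defines "G \<equiv> (\<alpha> * f u)\<^sup>2 - \<delta> * (\<beta> * g u)\<^sup>2"
  shows "form_E X u v = E" "form_F X u v = 0" "form_G X u v = G"
    and "E \<noteq> 0 \<Longrightarrow> G \<noteq> 0 \<Longrightarrow> gaussian_curvature X u v =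
      (\<alpha>\<^sup>2 * \<beta>\<^sup>2 * (g u * deriv f u - f u * deriv g u)\<^sup>2 * (\<delta> * E)
       - G * (\<alpha>\<^sup>2 * f u * deriv g u + \<beta>\<^sup>2 * g u * deriv f u)
         * (\<delta> * (deriv (deriv f) u * deriv g u - deriv f u * deriv (deriv g) u)))
      / (G\<^sup>2 * E\<^sup>2)"
proof -
  have Xu: "d_u X s v = vector [deriv f s * cos (\<alpha> * v), deriv f s * sin (\<alpha> * v),
      deriv g s * A v, deriv g s * B v]" if "s \<in> J" for s v
    unfolding d_u_def X_def
    by (rule vector_derivative_at, rule has_vector_derivative_vector_4)
      (auto intro!: derivative_eq_intros smooth_onD[OF f that] smooth_onD[OF g that])
  have Xv: "d_v X = (\<lambda>s v. vector [- (\<alpha> * f s) * sin (\<alpha> * v), \<alpha> * f s * cos (\<alpha> * v),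
      \<beta> * g s * B v, \<beta> * g s * A v])"
    unfolding d_v_def X_def
    by (intro ext vector_derivative_at has_vector_derivative_vector_4)
      (auto intro!: derivative_eq_intros A B)
  have Xuu: "d_u (d_u X) u v = vector [deriv (deriv f) u * cos (\<alpha> * v), deriv (deriv f) u * sin (\<alpha> * v),
      deriv (deriv g) u * A v, deriv (deriv g) u * B v]"
    unfolding d_u_def [of "d_u X"]
  proof (rule vector_derivative_at, rule has_vector_derivative_transform_within_open[OF _ J u])
    show "((\<lambda>s. vector [deriv f s * cos (\<alpha> * v), deriv f s * sin (\<alpha> * v),
        deriv g s * A v, deriv g s * B v] :: real^4) has_vector_derivative
      vector [deriv (deriv f) u * cos (\<alpha> * v), deriv (deriv f) u * sin (\<alpha> * v),
        deriv (deriv g) u * A v, deriv (deriv g) u * B v]) (at u)"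
      by (rule has_vector_derivative_vector_4)
        (auto intro!: derivative_eq_intros smooth_onD[OF f u] smooth_onD[OF g u])
  qed (simp add: Xu)
  have Xuv: "d_u (d_v X) u v = vector [- (\<alpha> * deriv f u) * sin (\<alpha> * v), \<alpha> * deriv f u * cos (\<alpha> * v),
      \<beta> * deriv g u * B v, \<beta> * deriv g u * A v]"
    unfolding Xv d_u_def
    by (rule vector_derivative_at, rule has_vector_derivative_vector_4)
      (auto intro!: derivative_eq_intros smooth_onD[OF f u] smooth_onD[OF g u])
  have Xvv: "d_v (d_v X) u v = vector [- \<alpha>\<^sup>2 * f u * cos (\<alpha> * v), - \<alpha>\<^sup>2 * f u * sin (\<alpha> * v),
      \<beta>\<^sup>2 * g u * A v, \<beta>\<^sup>2 * g u * B v]"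
    unfolding Xv d_v_def
    by (rule vector_derivative_at, rule has_vector_derivative_vector_4)
      (auto intro!: derivative_eq_intros A B simp: power2_eq_square)
  note X = Xu[OF u] Xv[THEN fun_cong, THEN fun_cong, of u v] Xuu Xuv Xvv
  have C: "(cos (\<alpha> * v))\<^sup>2 = 1 - (sin (\<alpha> * v))\<^sup>2" by (simp add: cos_squared_eq)
  have D: "(A v)\<^sup>2 = \<delta> + (B v)\<^sup>2" using AB[of v] by simp
  have prod: "lorentz (vector [a * cos (\<alpha> * v), a * sin (\<alpha> * v), b * A v, b * B v])
        (vector [a' * cos (\<alpha> * v), a' * sin (\<alpha> * v), b' * A v, b' * B v]) = a * a' + \<delta> * b * b'"
      "lorentz (vector [a * cos (\<alpha> * v), a * sin (\<alpha> * v), b * A v, b * B v])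
        (vector [- a' * sin (\<alpha> * v), a' * cos (\<alpha> * v), b' * B v, b' * A v]) = 0"
      "lorentz (vector [- a * sin (\<alpha> * v), a * cos (\<alpha> * v), b * B v, b * A v])
        (vector [a' * cos (\<alpha> * v), a' * sin (\<alpha> * v), b' * A v, b' * B v]) = 0"
      "lorentz (vector [- a * sin (\<alpha> * v), a * cos (\<alpha> * v), b * B v, b * A v])
        (vector [- a' * sin (\<alpha> * v), a' * cos (\<alpha> * v), b' * B v, b' * A v]) = a * a' - \<delta> * b * b'"
    for a b a' b'
  proof -
    have "a * cos (\<alpha> * v) * (a' * cos (\<alpha> * v)) + a * sin (\<alpha> * v) * (a' * sin (\<alpha> * v)) = a * a'"
      using C by algebra
    moreover have "b * A v * (b' * A v) - b * B v * (b' * B v) = \<delta> * b * b'"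
      using D by algebra
    ultimately show "lorentz (vector [a * cos (\<alpha> * v), a * sin (\<alpha> * v), b * A v, b * B v])
        (vector [a' * cos (\<alpha> * v), a' * sin (\<alpha> * v), b' * A v, b' * B v]) = a * a' + \<delta> * b * b'"
      "lorentz (vector [- a * sin (\<alpha> * v), a * cos (\<alpha> * v), b * B v, b * A v])
        (vector [- a' * sin (\<alpha> * v), a' * cos (\<alpha> * v), b' * B v, b' * A v]) = a * a' - \<delta> * b * b'"
      by (simp_all add: lorentz_def algebra_simps)
  qed (simp_all add: lorentz_def algebra_simps)
  show E: "form_E X u v = E" and F: "form_F X u v = 0" and G: "form_G X u v = G"
    unfolding form_E_def form_F_def form_G_def X prod E_def G_def
    by (simp_all add: power2_eq_square algebra_simps)
  assume nz: "E \<noteq> 0" "G \<noteq> 0"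
  define f1 g1 f2 g2 where "f1 = deriv f u" "g1 = deriv g u"
    "f2 = deriv (deriv f) u" "g2 = deriv (deriv g) u"
  note d = this [symmetric]
  have "gaussian_curvature X u v =
     (- \<alpha>\<^sup>2 * f u * f2 + \<delta> * \<beta>\<^sup>2 * g u * g2
       - (f1 * f2 + \<delta> * g1 * g2) * (- \<alpha>\<^sup>2 * f u * f1 + \<delta> * \<beta>\<^sup>2 * g u * g1) / E
       - (\<alpha>\<^sup>2 * f1\<^sup>2 - \<delta> * \<beta>\<^sup>2 * g1\<^sup>2 - (\<alpha>\<^sup>2 * f1 * f u - \<delta> * \<beta>\<^sup>2 * g1 * g u)\<^sup>2 / G)) / (E * G)"
    using nz unfolding gaussian_curvature_def form_W_def
      lorentz_normal_part[OF F, unfolded E G, OF nz] E F G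
    by (simp only: X prod d) (simp add: power2_eq_square algebra_simps)
  also have "\<dots> = ((- \<alpha>\<^sup>2 * f u * f2 + \<delta> * \<beta>\<^sup>2 * g u * g2) * E * G
       - (f1 * f2 + \<delta> * g1 * g2) * (- \<alpha>\<^sup>2 * f u * f1 + \<delta> * \<beta>\<^sup>2 * g u * g1) * G
       - (\<alpha>\<^sup>2 * f1\<^sup>2 - \<delta> * \<beta>\<^sup>2 * g1\<^sup>2) * E * G
       + (\<alpha>\<^sup>2 * f1 * f u - \<delta> * \<beta>\<^sup>2 * g1 * g u)\<^sup>2 * E) / (G\<^sup>2 * E\<^sup>2)"
    using nz by (simp add: divide_simps) (simp add: power2_eq_square algebra_simps)
  also have "\<dots> = (\<alpha>\<^sup>2 * \<beta>\<^sup>2 * (g u * f1 - f u * g1)\<^sup>2 * (\<delta> * E)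
       - G * (\<alpha>\<^sup>2 * f u * g1 + \<beta>\<^sup>2 * g u * f1) * (\<delta> * (f2 * g1 - f1 * g2))) / (G\<^sup>2 * E\<^sup>2)"
    unfolding E_def G_def d by (rule arg_cong[where f = "\<lambda>x. x / _"]) algebra
  finally show "gaussian_curvature X u v =
      (\<alpha>\<^sup>2 * \<beta>\<^sup>2 * (g u * deriv f u - f u * deriv g u)\<^sup>2 * (\<delta> * E)
       - G * (\<alpha>\<^sup>2 * f u * deriv g u + \<beta>\<^sup>2 * g u * deriv f u)
         * (\<delta> * (deriv (deriv f) u * deriv g u - deriv f u * deriv (deriv g) u)))
      / (G\<^sup>2 * E\<^sup>2)"
    unfolding d .
qed

lemma rotational_surface_timelike_curvature:
  assumes i: "i \<in> {1, 2}" and J: "open J" and f: "smooth_on f J" and g: "smooth_on g J" and u: "u \<in> J"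
    and c1: "i = 1 \<longrightarrow> \<alpha>\<^sup>2 * (f u)\<^sup>2 - \<beta>\<^sup>2 * (g u)\<^sup>2 < 0 \<and> (deriv f u)\<^sup>2 + (deriv g u)\<^sup>2 > 0"
    and c2: "i = 2 \<longrightarrow> (deriv f u)\<^sup>2 - (deriv g u)\<^sup>2 < 0 \<and> \<alpha>\<^sup>2 * (f u)\<^sup>2 + \<beta>\<^sup>2 * (g u)\<^sup>2 > 0"
  shows "timelike_at (rotational_surface i \<alpha> \<beta> f g) u v"
    and "gaussian_curvature (rotational_surface i \<alpha> \<beta> f g) u v = rotational_curvature i \<alpha> \<beta> f g u"
proof -
  have X1: "rotational_surface 1 \<alpha> \<beta> f g = (\<lambda>u v. vector [f u * cos (\<alpha> * v), f u * sin (\<alpha> * v),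
      g u * cosh (\<beta> * v), g u * sinh (\<beta> * v)])"
    and X2: "rotational_surface 2 \<alpha> \<beta> f g = (\<lambda>u v. vector [f u * cos (\<alpha> * v), f u * sin (\<alpha> * v),
      g u * sinh (\<beta> * v), g u * cosh (\<beta> * v)])"
    by (intro ext; simp add: rotational_surface_def)+
  have ch: "((\<lambda>v. cosh (\<beta> * v)) has_real_derivative \<beta> * sinh (\<beta> * s)) (at s)"
    and sh: "((\<lambda>v. sinh (\<beta> * v)) has_real_derivative \<beta> * cosh (\<beta> * s)) (at s)" for s
    by (auto intro!: derivative_eq_intros)
  have p1: "(cosh (\<beta> * s))\<^sup>2 - (sinh (\<beta> * s))\<^sup>2 = 1"
    and p2: "(sinh (\<beta> * s))\<^sup>2 - (cosh (\<beta> * s))\<^sup>2 = - 1" for s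
    by (simp_all add: cosh_square_eq)
  note r1 = rotational_aux[OF J f g u ch sh p1, of \<alpha> v, folded X1]
  note r2 = rotational_aux[OF J f g u sh ch p2, of \<alpha> v, folded X2]
  have "timelike_at (rotational_surface i \<alpha> \<beta> f g) u v \<and>
    gaussian_curvature (rotational_surface i \<alpha> \<beta> f g) u v = rotational_curvature i \<alpha> \<beta> f g u"
  proof (cases "i = 1")
    case True
    then have h: "(\<alpha> * f u)\<^sup>2 - (\<beta> * g u)\<^sup>2 < 0" "(deriv f u)\<^sup>2 + (deriv g u)\<^sup>2 > 0"
      using c1 by (simp_all add: power_mult_distrib)
    from h have nz: "(deriv f u)\<^sup>2 + 1 * (deriv g u)\<^sup>2 \<noteq> 0" "(\<alpha> * f u)\<^sup>2 - 1 * (\<beta> * g u)\<^sup>2 \<noteq> 0"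
      by linarith+
    from h have "timelike_at (rotational_surface 1 \<alpha> \<beta> f g) u v"
      unfolding timelike_at_def form_W_def r1(1-3) by (simp add: mult_pos_neg)
    moreover have "gaussian_curvature (rotational_surface 1 \<alpha> \<beta> f g) u v = rotational_curvature 1 \<alpha> \<beta> f g u"
      unfolding r1(4)[OF nz] by (simp add: rotational_curvature_def Let_def algebra_simps)
    ultimately show ?thesis using True by simp
  next
    case False
    then have i2: "i = 2" using i by simp
    then have h: "(deriv f u)\<^sup>2 - (deriv g u)\<^sup>2 < 0" "(\<alpha> * f u)\<^sup>2 + (\<beta> * g u)\<^sup>2 > 0"
      using c2 by (simp_all add: power_mult_distrib)
    from h have nz: "(deriv f u)\<^sup>2 + - 1 * (deriv g u)\<^sup>2 \<noteq> 0" "(\<alpha> * f u)\<^sup>2 - - 1 * (\<beta> * g u)\<^sup>2 \<noteq> 0"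
      by linarith+
    from h have "timelike_at (rotational_surface 2 \<alpha> \<beta> f g) u v"
      unfolding timelike_at_def form_W_def r2(1-3) by (simp add: mult_neg_pos)
    moreover have "gaussian_curvature (rotational_surface 2 \<alpha> \<beta> f g) u v = rotational_curvature 2 \<alpha> \<beta> f g u"
      unfolding r2(4)[OF nz] by (simp add: rotational_curvature_def Let_def power2_commute algebra_simps)
    ultimately show ?thesis using i2 by simp
  qed
  then show "timelike_at (rotational_surface i \<alpha> \<beta> f g) u v"
    and "gaussian_curvature (rotational_surface i \<alpha> \<beta> f g) u v = rotational_curvature i \<alpha> \<beta> f g u"
    by simp_all
qed

end

theory Submission
  imports Defs
begin

text \<open>
  Both terms of the weighted curvature vanish. The quadratic exponent has the constant Laplacian
  \<open>2 (l\<^sub>1 + l\<^sub>2 + l\<^sub>3 - l\<^sub>4)\<close>, where the last sign comes from the timelike coordinate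
  (\<open>laplacian_diagonal_quadratic\<close>), so the hypothesis on the coefficients says that the
  exponent is harmonic. The numerator of the Gaussian curvature, in the form given by
  \<open>rotational_surface_timelike_curvature\<close>, is a combination of two Wronskians, that of \<open>f, g\<close> and that of \<open>f', g'\<close>. A linear relation between \<open>f\<close> and \<open>g\<close> passes
  to all derivatives (\<open>linearly_dependent_on_deriv\<close>), so both are zero (\<open>wronskian_eq_0\<close>).
  Geometrically, the curve \<open>(f, g)\<close> then lies on a line through the origin.
\<close>

lemma partial_diagonal_quadratic:
  fixes c :: "real^4"
  shows "partial k (\<lambda>p. \<Sum>j\<in>UNIV. c$j * (p$j)\<^sup>2) = (\<lambda>p. 2 * c$k * p$k)"
proof
  fix p :: "real^4"
  have "((\<lambda>h. \<Sum>j\<in>UNIV. c$j * ((p + h *\<^sub>R axis k 1)$j)\<^sup>2)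
          has_real_derivative (\<Sum>j\<in>UNIV. 2 * c$j * p$j * axis k 1$j)) (at 0)"
    by (auto intro!: derivative_eq_intros sum.cong)
  also have "(\<Sum>j\<in>UNIV. 2 * c$j * p$j * axis k 1$j) = 2 * c$k * p$k"
    by (simp add: axis_def if_distrib cong: if_cong)
  finally show "partial k (\<lambda>p. \<Sum>j\<in>UNIV. c$j * (p$j)\<^sup>2) p = 2 * c$k * p$k"
    unfolding partial_def by (rule DERIV_imp_deriv)
qed

lemma partial_linear: "partial k (\<lambda>p. a * p$k) p = a"
  unfolding partial_def
  by (rule DERIV_imp_deriv) (auto intro!: derivative_eq_intros simp: axis_def)

lemma laplacian_diagonal_quadratic:
  "laplacian (\<lambda>p. l\<^sub>1 * (p$1)\<^sup>2 + l\<^sub>2 * (p$2)\<^sup>2 + l\<^sub>3 * (p$3)\<^sup>2 + l\<^sub>4 * (p$4)\<^sup>2) p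
    = 2 * (l\<^sub>1 + l\<^sub>2 + l\<^sub>3 - l\<^sub>4)"
proof -
  define c :: "real^4" where "c = vector [l\<^sub>1, l\<^sub>2, l\<^sub>3, l\<^sub>4]"
  have "(\<lambda>p. l\<^sub>1 * (p$1)\<^sup>2 + l\<^sub>2 * (p$2)\<^sup>2 + l\<^sub>3 * (p$3)\<^sup>2 + l\<^sub>4 * (p$4)\<^sup>2)
      = (\<lambda>p::real^4. \<Sum>j\<in>UNIV. c$j * (p$j)\<^sup>2)"
    by (simp add: sum_4 c_def)
  then show ?thesis
    by (simp add: laplacian_def partial_diagonal_quadratic partial_linear c_def)
qed

text \<open>Since \<open>J\<close> is open, the relation holds in a neighbourhood of \<open>u\<close>, so its left-hand side has
  both the derivative given by the sum rule and the derivative \<open>0\<close>.\<close>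

lemma linear_relation_deriv:
  fixes f g :: "real \<Rightarrow> real"
  assumes "open J" and u: "u \<in> J"
    and f: "(f has_real_derivative f') (at u)" and g: "(g has_real_derivative g') (at u)"
    and rel: "\<And>s. s \<in> J \<Longrightarrow> a * f s + b * g s = 0"
  shows "a * f' + b * g' = 0"
proof (rule DERIV_unique)
  show "((\<lambda>s. a * f s + b * g s) has_real_derivative a * f' + b * g') (at u)"
    by (auto intro!: derivative_eq_intros f g)
  show "((\<lambda>s. a * f s + b * g s) has_real_derivative 0) (at u)"
    by (rule has_field_derivative_transform_within_open[OF DERIV_const \<open>open J\<close> u])
      (simp add: rel)
qed

lemma linearly_dependent_on_deriv:
  assumes "open J" and "\<And>u. u \<in> J \<Longrightarrow> (f has_real_derivative deriv f u) (at u)"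
    and "\<And>u. u \<in> J \<Longrightarrow> (g has_real_derivative deriv g u) (at u)"
    and "linearly_dependent_on f g J"
  shows "linearly_dependent_on (deriv f) (deriv g) J"
  using assms(4) linear_relation_deriv[OF assms(1) _ assms(2,3)]
  unfolding linearly_dependent_on_def by blast

text \<open>The coefficients of the relation form a nonzero vector in the kernel of the Wronskian matrix,
  whose second row is the differentiated relation.\<close>

lemma wronskian_eq_0:
  assumes "open J" and u: "u \<in> J"
    and f: "(f has_real_derivative f') (at u)" and g: "(g has_real_derivative g') (at u)"
    and "linearly_dependent_on f g J"
  shows "f u * g' - f' * g u = 0"
proof -
  obtain a b where ab: "(a, b) \<noteq> (0, 0)" and rel: "\<And>s. s \<in> J \<Longrightarrow> a * f s + b * g s = 0"
    using assms(5) unfolding linearly_dependent_on_def by blast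
  have "a * f u + b * g u = 0" "a * f' + b * g' = 0"
    using rel[OF u] linear_relation_deriv[OF \<open>open J\<close> u f g rel] by auto
  then have "a * (f u * g' - f' * g u) = 0" "b * (f u * g' - f' * g u) = 0"
    by algebra+
  then show ?thesis using ab by auto
qed

lemma rotational_curvature_eq_0:
  assumes J: "open J" and f: "smooth_on f J" and g: "smooth_on g J"
    and dep: "linearly_dependent_on f g J" and u: "u \<in> J"
  shows "rotational_curvature i \<alpha> \<beta> f g u = 0"
proof -
  have "linearly_dependent_on (deriv f) (deriv g) J"
    using J smooth_onD(1)[OF f] smooth_onD(1)[OF g] dep by (rule linearly_dependent_on_deriv)
  then have "deriv f u * deriv (deriv g) u - deriv (deriv f) u * deriv g u = 0"
    using wronskian_eq_0[OF J u smooth_onD(2)[OF f u] smooth_onD(2)[OF g u]] by blast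
  moreover have "f u * deriv g u - deriv f u * g u = 0"
    using J u smooth_onD(1)[OF f u] smooth_onD(1)[OF g u] dep by (rule wronskian_eq_0)
  ultimately have "g u * deriv f u - f u * deriv g u = 0"
      "deriv (deriv f) u * deriv g u - deriv f u * deriv (deriv g) u = 0"
    by (simp_all add: mult.commute)
  then show ?thesis
    unfolding rotational_curvature_def Let_def by simp
qed

theorem theorem7:
  fixes i :: nat and \<alpha> \<beta> l\<^sub>1 l\<^sub>2 l\<^sub>3 l\<^sub>4 :: real and J :: "real set" and f g :: "real \<Rightarrow> real"
  assumes "i \<in> {1, 2}"
    and "\<alpha> > 0" and "\<beta> > 0"
    and "open J" and "is_interval J"
    and "smooth_on f J" and "smooth_on g J"
    and "i = 1 \<longrightarrow> (\<forall>u\<in>J. \<alpha>\<^sup>2 * (f u)\<^sup>2 - \<beta>\<^sup>2 * (g u)\<^sup>2 < 0 \<and> (deriv f u)\<^sup>2 + (deriv g u)\<^sup>2 > 0)"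
    and "i = 2 \<longrightarrow> (\<forall>u\<in>J. (deriv f u)\<^sup>2 - (deriv g u)\<^sup>2 < 0 \<and> \<alpha>\<^sup>2 * (f u)\<^sup>2 + \<beta>\<^sup>2 * (g u)\<^sup>2 > 0)"
    and "(l\<^sub>1, l\<^sub>2, l\<^sub>3, l\<^sub>4) \<noteq> (0, 0, 0, 0)"
    and "l\<^sub>1 + l\<^sub>2 + l\<^sub>3 = l\<^sub>4"
    and "linearly_dependent_on f g J"
  shows "weighted_flat_on
           (\<lambda>p. l\<^sub>1 * (p$1)\<^sup>2 + l\<^sub>2 * (p$2)\<^sup>2 + l\<^sub>3 * (p$3)\<^sup>2 + l\<^sub>4 * (p$4)\<^sup>2)
           (rotational_surface i \<alpha> \<beta> f g) (J \<times> {0..<2 * pi})"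
proof -
  have "weighted_gaussian_curvature
      (\<lambda>p. l\<^sub>1 * (p$1)\<^sup>2 + l\<^sub>2 * (p$2)\<^sup>2 + l\<^sub>3 * (p$3)\<^sup>2 + l\<^sub>4 * (p$4)\<^sup>2)
      (rotational_surface i \<alpha> \<beta> f g) u v = 0" if u: "u \<in> J" for u v
  proof -
    have "gaussian_curvature (rotational_surface i \<alpha> \<beta> f g) u v = rotational_curvature i \<alpha> \<beta> f g u"
      using assms(1,4,6,7) u
      by (rule rotational_surface_timelike_curvature(2)) (use assms(8,9) u in blast)+
    also have "\<dots> = 0"
      using assms(4,6,7,12) u by (rule rotational_curvature_eq_0)
    finally show ?thesis
      using assms(11) by (simp add: weighted_gaussian_curvature_def laplacian_diagonal_quadratic)
  qed
  then show ?thesis by (auto simp: weighted_flat_on_def)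
qed

end
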